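(* Let $E,F$ be Banach spaces over the same field $\mathbb K\in\{\mathbb R,\mathbb C\}$, let $U\subseteq E$ be open and let $f\colon U\to F$ be differentiable (at every point of $U$). Let $A\in\mathcal L(E,F)$ and let $x,y\in U$ be distinct points such that the line segment $[\![x,y]\!]:=\{x+t(y-x)\colon t\in[0,1]\}$ is contained in $U$. Then there exists $c\in[\![x,y]\!]$, $c\neq x,y$, such that $$\|f(y)-f(x)-A(y-x)\|\leq\|Df(c)(y-x)-A(y-x)\|.$$
   Context: $\mathcal L(E,F)$ denotes the space of bounded linear operators from $E$ to $F$ with the operator norm. Differentiability: $f\colon U\to F$ is differentiable at $x\in U$ if there exists a map $\Phi_x\colon U\to\mathcal L(E,F)$, continuous at $x$, such that $f(y)=f(x)+\Phi_x(y)(y-x)$ for all $y\in U$; then $Df(x):=\Phi_x(x)$ is the derivative of $f$ at $x$ (this is equivalent to Fréchet differentiability, with the same derivative). *)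

theory Defs
  imports "HOL-Analysis.Analysis"
begin

(* The scalar field K in {R, C}: a normed field that is isometrically isomorphic,
   as a real algebra, to the reals or to the complex numbers. *)

class real_or_complex = real_normed_field +
  assumes real_or_complex:
    "\<exists>\<phi> :: 'a \<Rightarrow> complex. (\<forall>a b. \<phi> (a + b) = \<phi> a + \<phi> b) \<and> (\<forall>r a. \<phi> (r *\<^sub>R a) = r *\<^sub>R \<phi> a) \<and>
       (\<forall>a b. \<phi> (a * b) = \<phi> a * \<phi> b) \<and> (\<forall>a. norm (\<phi> a) = norm a) \<and>
       (range \<phi> = \<real> \<or> range \<phi> = UNIV)"

instance real :: real_or_complex
proof
  show "\<exists>\<phi> :: real \<Rightarrow> complex. (\<forall>a b. \<phi> (a + b) = \<phi> a + \<phi> b) \<and> (\<forall>r a. \<phi> (r *\<^sub>R a) = r *\<^sub>R \<phi> a) \<and>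
       (\<forall>a b. \<phi> (a * b) = \<phi> a * \<phi> b) \<and> (\<forall>a. norm (\<phi> a) = norm a) \<and>
       (range \<phi> = \<real> \<or> range \<phi> = UNIV)"
    by (intro exI[of _ complex_of_real]) (auto simp: Reals_def scaleR_conv_of_real)
qed

instance complex :: real_or_complex
proof
  show "\<exists>\<phi> :: complex \<Rightarrow> complex. (\<forall>a b. \<phi> (a + b) = \<phi> a + \<phi> b) \<and> (\<forall>r a. \<phi> (r *\<^sub>R a) = r *\<^sub>R \<phi> a) \<and>
       (\<forall>a b. \<phi> (a * b) = \<phi> a * \<phi> b) \<and> (\<forall>a. norm (\<phi> a) = norm a) \<and>
       (range \<phi> = \<real> \<or> range \<phi> = UNIV)"
    by (intro exI[of _ "\<lambda>z. z"]) auto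
qed

(* A Banach space over K: the class banach supplies the complete norm and the underlying
   real structure, and s is a K-scalar multiplication extending the real one.
   For K = R this forces s = scaleR. *)

locale banach_over = vector_space s
  for s :: "'k :: real_or_complex \<Rightarrow> 'e :: banach \<Rightarrow> 'e" +
  assumes scale_of_real: "s (of_real r) x = r *\<^sub>R x"
    and norm_scale: "norm (s a x) = norm a * norm x"

(* The K-linear members of the space of bounded real-linear operators;
   the type of the latter carries the operator norm. *)

definition bounded_operators ::
  "('k :: real_or_complex \<Rightarrow> 'e :: banach \<Rightarrow> 'e) \<Rightarrow> ('k \<Rightarrow> 'f :: banach \<Rightarrow> 'f) \<Rightarrow> ('e \<Rightarrow>\<^sub>L 'f) set"
  where "bounded_operators sE sF =
    {T. \<forall>a x. blinfun_apply T (sE a x) = sF a (blinfun_apply T x)}"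

definition has_deriv_in ::
  "('k :: real_or_complex \<Rightarrow> 'e :: banach \<Rightarrow> 'e) \<Rightarrow> ('k \<Rightarrow> 'f :: banach \<Rightarrow> 'f) \<Rightarrow> 'e set \<Rightarrow>
   ('e \<Rightarrow> 'f) \<Rightarrow> 'e \<Rightarrow> ('e \<Rightarrow>\<^sub>L 'f) \<Rightarrow> bool"
  where "has_deriv_in sE sF U f x T \<longleftrightarrow>
    (\<exists>\<Phi>. \<Phi> \<in> U \<rightarrow> bounded_operators sE sF \<and> continuous (at x within U) \<Phi> \<and>
         (\<forall>y\<in>U. f y = f x + blinfun_apply (\<Phi> y) (y - x)) \<and> \<Phi> x = T)"

definition differentiable_in ::
  "('k :: real_or_complex \<Rightarrow> 'e :: banach \<Rightarrow> 'e) \<Rightarrow> ('k \<Rightarrow> 'f :: banach \<Rightarrow> 'f) \<Rightarrow> 'e set \<Rightarrow>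
   ('e \<Rightarrow> 'f) \<Rightarrow> 'e \<Rightarrow> bool"
  where "differentiable_in sE sF U f x \<longleftrightarrow> (\<exists>T. has_deriv_in sE sF U f x T)"

definition deriv_in ::
  "('k :: real_or_complex \<Rightarrow> 'e :: banach \<Rightarrow> 'e) \<Rightarrow> ('k \<Rightarrow> 'f :: banach \<Rightarrow> 'f) \<Rightarrow> 'e set \<Rightarrow>
   ('e \<Rightarrow> 'f) \<Rightarrow> 'e \<Rightarrow> ('e \<Rightarrow>\<^sub>L 'f)"
  where "deriv_in sE sF U f x = (THE T. has_deriv_in sE sF U f x T)"

lemma has_deriv_in_imp_has_derivative:
  assumes "has_deriv_in sE sF U f x T" and "x \<in> U"
  shows "(f has_derivative blinfun_apply T) (at x within U)"
proof -
  obtain \<Phi> where c: "continuous (at x within U) \<Phi>"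
    and f: "\<And>y. y \<in> U \<Longrightarrow> f y = f x + blinfun_apply (\<Phi> y) (y - x)" and T: "\<Phi> x = T"
    using assms unfolding has_deriv_in_def by blast
  have "((\<lambda>y. norm (\<Phi> y - T)) \<longlongrightarrow> 0) (at x within U)"
    using c T by (simp add: continuous_within LIM_zero_iff tendsto_norm_zero_iff)
  moreover have "\<forall>\<^sub>F y in at x within U.
      norm ((f y - f x - blinfun_apply T (y - x)) /\<^sub>R norm (y - x)) \<le> norm (\<Phi> y - T)"
  proof -
    have "norm ((f y - f x - blinfun_apply T (y - x)) /\<^sub>R norm (y - x)) \<le> norm (\<Phi> y - T)"
      if "y \<in> U" "y \<noteq> x" for y
    proof -
      have "f y - f x - blinfun_apply T (y - x) = blinfun_apply (\<Phi> y - T) (y - x)"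
        using f[OF that(1)] by (simp add: blinfun.diff_left)
      then show ?thesis
        using norm_blinfun[of "\<Phi> y - T" "y - x"] that(2) by (simp add: field_simps)
    qed
    then show ?thesis by (auto simp: eventually_at_filter)
  qed
  ultimately have "((\<lambda>y. (f y - f x - blinfun_apply T (y - x)) /\<^sub>R norm (y - x)) \<longlongrightarrow> 0) (at x within U)"
    by (rule Lim_null_comparison[rotated])
  then show ?thesis
    by (simp add: has_derivative_at_within blinfun.bounded_linear_right diff_diff_add)
qed

lemma deriv_in_eq:
  assumes "open U" and "x \<in> U" and "has_deriv_in sE sF U f x T"
  shows "deriv_in sE sF U f x = T"
  unfolding deriv_in_def
proof (rule the_equality)
  fix S assume "has_deriv_in sE sF U f x S"
  then have "(f has_derivative blinfun_apply S) (at x)"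
    and "(f has_derivative blinfun_apply T) (at x)"
    using assms has_deriv_in_imp_has_derivative at_within_open by metis+
  then show "S = T"
    by (metis has_derivative_unique blinfun_apply_inject)
qed (fact assms)

end

theory Submission imports Defs begin

text \<open>
  Put \<open>g t = f (x + t (y - x)) - t A (y - x)\<close> on \<open>[0, 1]\<close>. Then
  \<open>g 1 - g 0 = f y - f x - A (y - x)\<close> and \<open>g' t = Df(c) (y - x) - A (y - x)\<close> with
  \<open>c = x + t (y - x)\<close>, so the claim is a mean value theorem for a curve \<open>g\<close> in a normed space:
  \<open>norm (g b - g a) \<le> (b - a) * norm (g' t)\<close> for some interior \<open>t\<close>
  (\<open>exists_derivative_ge_mean_slope\<close>). One can reduce this to real-valued functions by a
  norming functional from the Hahn-Banach theorem; the following argument is more elementary.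
  Suppose that \<open>norm (g' t) < M\<close> at every interior \<open>t\<close>, where \<open>M\<close> is
  the mean slope. The usual mean value inequality only bounds each increment by \<open>M\<close> times the length of
  the interval, which is not yet a contradiction. But at a single interior point \<open>m\<close> the strict inequality
  \<open>norm (g' m) < M\<close> passes to the difference quotients at \<open>m\<close>, so on a short interval
  \<open>[m, d]\<close> the increment is strictly smaller than \<open>M (d - m)\<close>. Adding the three increments over
  \<open>[a, m]\<close>, \<open>[m, d]\<close> and \<open>[d, b]\<close> gives \<open>norm (g b - g a) < M (b - a)\<close>, a contradiction.
\<close>

text \<open>
  The difference quotients at \<open>m\<close> tend to \<open>g'\<close>, so those close to \<open>m\<close> inherit the open
  condition of having norm below \<open>M\<close>. This supplies the strict inequality that the mean
  value inequality alone cannot give.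
\<close>
lemma increment_less_right_of_point:
  fixes g :: "real \<Rightarrow> 'a :: real_normed_vector"
  assumes "(g has_vector_derivative g') (at m)" and "norm g' < M" and "m < b"
  obtains d where "m < d" "d < b" "norm (g d - g m) < M * (d - m)"
proof -
  define e where "e = (M - norm g') / 2"
  have "e > 0" using assms(2) by (simp add: e_def)
  have "(g has_derivative (\<lambda>h. h *\<^sub>R g')) (at_right m)"
    using has_vector_derivative_at_within[OF assms(1)] by (simp add: has_vector_derivative_def)
  then have "\<forall>\<^sub>F t in at_right m. norm (g t - g m - (t - m) *\<^sub>R g') \<le> e * norm (t - m)"
    using \<open>e > 0\<close> by (simp add: has_derivative_within_alt2)
  moreover have "\<forall>\<^sub>F t in at_right m. t \<in> {m<..<b}"
    using assms(3) by (rule eventually_at_right_real)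
  ultimately have "\<forall>\<^sub>F t in at_right m.
      t \<in> {m<..<b} \<and> norm (g t - g m - (t - m) *\<^sub>R g') \<le> e * norm (t - m)"
    by eventually_elim simp
  then obtain d where d: "m < d" "d < b" "norm (g d - g m - (d - m) *\<^sub>R g') \<le> e * (d - m)"
    using eventually_happens'[OF trivial_limit_at_right_real] by fastforce
  have "norm (g d - g m) \<le> norm (g d - g m - (d - m) *\<^sub>R g') + (d - m) * norm g'"
    using d norm_triangle_ineq[of "g d - g m - (d - m) *\<^sub>R g'" "(d - m) *\<^sub>R g'"]
    by simp
  also have "\<dots> \<le> (e + norm g') * (d - m)"
    using d by (simp add: distrib_right mult.commute[of "norm g'"])
  also have "\<dots> < M * (d - m)"
    using d \<open>e > 0\<close> by (intro mult_strict_right_mono) (auto simp: e_def field_simps)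
  finally show thesis
    using that d by blast
qed

text \<open>
  The bounds that the mean value inequality gives on adjacent intervals add up without loss. So if
  the derivative were below the mean slope \<open>M\<close> in norm everywhere inside, a strict gain on one
  subinterval, however short, would make the norm of the total increment less than \<open>M * (b - a)\<close>,
  which is its value.
\<close>
lemma exists_derivative_ge_mean_slope:
  fixes g :: "real \<Rightarrow> 'a :: real_normed_vector"
  assumes "a < b" and cont: "continuous_on {a..b} g"
    and deriv: "\<And>t. a < t \<Longrightarrow> t < b \<Longrightarrow> (g has_vector_derivative g' t) (at t)"
  shows "\<exists>t\<in>{a<..<b}. norm (g b - g a) \<le> (b - a) * norm (g' t)"
proof (rule ccontr)
  define M where "M = norm (g b - g a) / (b - a)"
  assume "\<not> ?thesis"
  then have less: "norm (g' t) < M" if "a < t" "t < b" for t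
    using that \<open>a < b\<close> by (force simp: M_def field_simps not_le)
  have bound: "norm (g v - g u) \<le> M * (v - u)" if "a \<le> u" "u < v" "v \<le> b" for u v
  proof -
    have "norm (g v - g u) \<le> M * v - M * u"
    proof (rule differentiable_bound_general[where f' = g' and \<phi>' = "\<lambda>_. M"])
      show "continuous_on {u..v} g"
        using cont that by (rule_tac continuous_on_subset) auto
      show "(g has_vector_derivative g' t) (at t)" if "u < t" "t < v" for t
        using deriv that \<open>a \<le> u\<close> \<open>v \<le> b\<close> by simp
      show "norm (g' t) \<le> M" if "u < t" "t < v" for t
        using less[of t] that \<open>a \<le> u\<close> \<open>v \<le> b\<close> by simp
    qed (use that in \<open>auto intro!: continuous_intros derivative_eq_intros
           simp: has_real_derivative_iff_has_vector_derivative[symmetric]\<close>)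
    then show ?thesis by (simp add: algebra_simps)
  qed
  \<comment> \<open>Any interior point would serve as \<open>m\<close>.\<close>
  define m where "m = (a + b) / 2"
  have m: "a < m" "m < b" using \<open>a < b\<close> by (auto simp: m_def)
  obtain d where d: "m < d" "d < b" "norm (g d - g m) < M * (d - m)"
    using increment_less_right_of_point[OF deriv[OF m] less[OF m] m(2)] by blast
  have "norm (g b - g a) = norm ((g b - g d) + (g d - g m) + (g m - g a))"
    by simp
  also have "\<dots> \<le> norm (g b - g d) + norm (g d - g m) + norm (g m - g a)"
    by (meson norm_triangle_ineq norm_triangle_mono order_refl)
  also have "\<dots> < M * (b - d) + M * (d - m) + M * (m - a)"
    using bound[of d b] bound[of a m] d m by simp
  also have "\<dots> = M * (b - a)"
    by (simp add: algebra_simps)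
  also have "\<dots> = norm (g b - g a)"
    using \<open>a < b\<close> by (simp add: M_def)
  finally show False by simp
qed

theorem theorem4p2:
  fixes sE :: "'k :: real_or_complex \<Rightarrow> 'e :: banach \<Rightarrow> 'e"
    and sF :: "'k \<Rightarrow> 'f :: banach \<Rightarrow> 'f"
    and U :: "'e set" and f :: "'e \<Rightarrow> 'f" and A :: "'e \<Rightarrow>\<^sub>L 'f" and x y :: 'e
  assumes "banach_over sE" and "banach_over sF"
    and "open U"
    and "\<And>z. z \<in> U \<Longrightarrow> differentiable_in sE sF U f z"
    and "A \<in> bounded_operators sE sF"
    and "x \<in> U" and "y \<in> U" and "x \<noteq> y"
    and "closed_segment x y \<subseteq> U"
  shows "\<exists>c \<in> closed_segment x y. c \<noteq> x \<and> c \<noteq> y \<and>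
    norm (f y - f x - blinfun_apply A (y - x))
      \<le> norm (blinfun_apply (deriv_in sE sF U f c) (y - x) - blinfun_apply A (y - x))"
proof -
  define p where "p t = x + t *\<^sub>R (y - x)" for t :: real
  define g where "g t = f (p t) - t *\<^sub>R blinfun_apply A (y - x)" for t
  define g' where "g' t = blinfun_apply (deriv_in sE sF U f (p t)) (y - x) - blinfun_apply A (y - x)"
    for t
  have p_segment: "p t \<in> closed_segment x y" if "0 \<le> t" "t \<le> 1" for t
    using that by (auto simp: p_def closed_segment_def algebra_simps intro!: exI[of _ t])
  have deriv: "(g has_vector_derivative g' t) (at t)" if "0 \<le> t" "t \<le> 1" for t
  proof -
    have "p t \<in> U" using p_segment that assms(9) by blast
    then obtain T where T: "has_deriv_in sE sF U f (p t) T"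
      using assms(4) by (auto simp: differentiable_in_def)
    have "(f has_derivative blinfun_apply (deriv_in sE sF U f (p t))) (at (p t))"
      using has_deriv_in_imp_has_derivative[OF T \<open>p t \<in> U\<close>] deriv_in_eq[OF \<open>open U\<close> \<open>p t \<in> U\<close> T]
        at_within_open[OF \<open>p t \<in> U\<close> \<open>open U\<close>] by simp
    moreover have "(p has_vector_derivative (y - x)) (at t)"
      unfolding p_def by (auto intro!: derivative_eq_intros)
    ultimately have "((\<lambda>t. f (p t)) has_vector_derivative
        blinfun_apply (deriv_in sE sF U f (p t)) (y - x)) (at t)"
      using vector_derivative_diff_chain_within[of p "y - x" t UNIV f]
      by (simp add: o_def has_derivative_at_withinI)
    then show ?thesis
      unfolding g_def g'_def by (auto intro!: derivative_eq_intros)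
  qed
  have "continuous_on {0..1} g"
    using deriv has_vector_derivative_continuous by (intro continuous_at_imp_continuous_on) force
  then obtain t where t: "0 < t" "t < 1" "norm (g 1 - g 0) \<le> norm (g' t)"
    using exists_derivative_ge_mean_slope[of 0 1 g g'] deriv by auto
  have "p t \<noteq> x" using t \<open>x \<noteq> y\<close> by (simp add: p_def)
  moreover have "p t \<noteq> y"
  proof
    assume "p t = y"
    then have "t *\<^sub>R (y - x) = 1 *\<^sub>R (y - x)"
      unfolding p_def by (metis add_diff_cancel_left' scaleR_one)
    then show False using t \<open>x \<noteq> y\<close> by (simp only: scaleR_cancel_right) simp
  qed
  moreover have "g 1 - g 0 = f y - f x - blinfun_apply A (y - x)"
    by (simp add: g_def p_def)
  ultimately show ?thesis
    using t p_segment[of t] by (auto simp: g'_def)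
qed

end
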